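(* Let $K$ be a (finite or infinite) field, $n\ge1$, and let $S,T\subseteq K^n$ be non-zero $K$-vector subspaces. Then $$\dim ST\ \ge\ \dim S+\dim T-\dim \operatorname{St}(ST).$$
   Context: $K^n$ is a $K$-algebra under coordinatewise multiplication $xy=(x_1y_1,\dots,x_ny_n)$. For $K$-subspaces $S,T\subseteq K^n$, $ST$ denotes the $K$-linear span of all products $xy$ with $x\in S$, $y\in T$. For a $K$-subspace $V\subseteq K^n$, its stabilizer is $\operatorname{St}(V)=\{x\in K^n: xV\subseteq V\}$, where $xV=\{xv:v\in V\}$. Dimensions are over $K$. *)

theory Defs
  imports "HOL-Analysis.Analysis"
begin

text \<open>
  The algebra K^n is the type \<open>'k ^ 'n\<close>, where n is the cardinality of the (finite, nonempty)
  index type \<open>'n\<close>. The library's multiplication on this type is coordinatewise, see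
  \<open>vector_mult_component\<close>. Linear notions over an arbitrary field are those of the
  interpretation \<open>vec\<close>, whose scalar multiplication is \<open>(*s)\<close>.
\<close>

definition span_prod :: "('k::field ^ 'n) set \<Rightarrow> ('k ^ 'n) set \<Rightarrow> ('k ^ 'n) set" where
  "span_prod S T = vec.span {x * y |x y. x \<in> S \<and> y \<in> T}"

definition stabilizer :: "('k::field ^ 'n) set \<Rightarrow> ('k ^ 'n) set" where
  "stabilizer V = {x. (\<lambda>v. x * v) ` V \<subseteq> V}"

end

theory Submission
  imports Defs "HOL-Computational_Algebra.Fraction_Field" "HOL-Computational_Algebra.Polynomial"
begin

text \<open>
  Over an infinite field, let \<open>A\<close>, \<open>B\<close> have full support and \<open>1 \<in> A\<close>. If \<open>A\<close> does not stabilize \<open>B\<close>,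
  then \<open>Ae\<close> is not contained in \<open>B\<close> for some invertible \<open>e \<in> B\<close>, and passing to
  \<open>A \<inter> e\<^sup>-\<^sup>1B\<close>, \<open>B + eA\<close> shrinks \<open>A\<close> but keeps the sum of dimensions; so some \<open>V\<close> with
  \<open>B \<subseteq> V \<subseteq> AB\<close> satisfies \<open>dim V + dim St(V) \<ge> dim A + dim B\<close>. Rescaling gives such a
  \<open>V\<^sub>a \<supseteq> aB\<close> for each invertible \<open>a \<in> A\<close>. Stabilizers are spanned by 0-1 vectors, so there are
  finitely many of them, and for one \<open>H\<close> the \<open>a\<close> with \<open>H = St(V\<^sub>a)\<close> span \<open>A\<close>; then \<open>AB\<close> is the sum
  of these \<open>V\<^sub>a\<close> and is stabilized by \<open>H\<close>. Finite fields are embedded in \<open>K(X)\<close>.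
\<close>

section \<open>Finite unions of subspaces\<close>

text \<open>In the inductive step, a line with base point outside \<open>W\<close> and direction
  \<open>v\<close> in \<open>W\<close> never meets \<open>W\<close>. Pigeonhole then puts infinitely
  many of its points into one other member, and two of them suffice to force \<open>v\<close> into
  it.\<close>

lemma subspace_subset_finite_union:
  fixes V :: "('k::field ^ 'n) set"
  assumes "finite F" and inf: "infinite (UNIV :: 'k set)"
    and "vec.subspace V" and "\<And>W. W \<in> F \<Longrightarrow> vec.subspace W" and "V \<subseteq> \<Union>F"
  shows "\<exists>W\<in>F. V \<subseteq> W"
  using assms(1,4,5)
proof (induction F rule: finite_induct)
  case empty
  then show ?case
    using vec.subspace_0[OF assms(3)] by auto
next
  case (insert W F)
  show ?case
  proof (rule ccontr)
    assume contra: "\<not> ?case"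
    then have "\<not> V \<subseteq> \<Union>F"
      using insert by auto
    then obtain v where v: "v \<in> V" "v \<notin> \<Union>F" by auto
    obtain u where u: "u \<in> V" "u \<notin> W" using contra by auto
    have vW: "v \<in> W" using v insert.prems by auto
    have W: "vec.subspace W" using insert.prems by auto
    have "\<exists>X\<in>F. u + t *s v \<in> X" for t
    proof -
      have "u + t *s v \<in> V"
        using u v assms(3) by (simp add: vec.subspace_add vec.subspace_scale)
      moreover have "u + t *s v \<notin> W"
        using vec.subspace_diff[OF W _ vec.subspace_scale[OF W vW, of t], of "u + t *s v"] u(2) by auto
      ultimately show ?thesis using insert.prems(2) by auto
    qed
    then obtain X where X: "X \<in> F" "infinite {t. u + t *s v \<in> X}"
      using pigeonhole_infinite_rel[OF inf insert.hyps(1), of "\<lambda>t X. u + t *s v \<in> X"] by auto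
    then obtain t where t: "u + t *s v \<in> X" using infinite_imp_nonempty by fastforce
    have "\<exists>s. s \<noteq> t \<and> u + s *s v \<in> X"
    proof (rule ccontr)
      assume "\<not> ?thesis"
      then have "{t. u + t *s v \<in> X} \<subseteq> {t}" by auto
      then show False using X(2) finite_subset by blast
    qed
    then obtain s where s: "s \<noteq> t" "u + s *s v \<in> X" by auto
    have sX: "vec.subspace X" using X insert.prems by auto
    have "(s - t) *s v \<in> X"
      using vec.subspace_diff[OF sX s(2) t] by (simp add: vec.scale_left_diff_distrib)
    then have "inverse (s - t) *s ((s - t) *s v) \<in> X"
      by (rule vec.subspace_scale[OF sX])
    then have "v \<in> X" using s(1) by (simp only: vec.scale_scale) simp
    then show False using v X(1) by auto
  qed
qed

section \<open>Products and stabilizers\<close>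

lemma subspace_span_prod: "vec.subspace (span_prod S T)"
  by (simp add: span_prod_def)

lemma mult_in_span_prod: "x \<in> S \<Longrightarrow> y \<in> T \<Longrightarrow> x * y \<in> span_prod S T"
  unfolding span_prod_def by (rule vec.span_base) auto

lemma span_prod_subset:
  assumes "vec.subspace V" and "\<And>x y. x \<in> S \<Longrightarrow> y \<in> T \<Longrightarrow> x * y \<in> V"
  shows "span_prod S T \<subseteq> V"
  unfolding span_prod_def by (rule vec.span_minimal) (use assms in auto)

lemma span_prod_mono: "S \<subseteq> S' \<Longrightarrow> T \<subseteq> T' \<Longrightarrow> span_prod S T \<subseteq> span_prod S' T'"
  unfolding span_prod_def by (rule vec.span_mono) auto

lemma linear_vec_mult_left: "Vector_Spaces.linear (*s) (*s) ((*) (e :: 'k::field ^ 'n))"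
  by unfold_locales (vector algebra_simps)+

lemmas subspace_vec_mult_image = vec.linear_subspace_image[OF linear_vec_mult_left]
lemmas subspace_vec_mult_vimage = vec.linear_subspace_vimage[OF linear_vec_mult_left]

lemma subspace_stabilizer:
  assumes "vec.subspace V"
  shows "vec.subspace (stabilizer V)"
proof (rule vec.subspaceI)
  show "0 \<in> stabilizer V"
    using vec.subspace_0[OF assms] by (auto simp: stabilizer_def)
next
  fix x y assume "x \<in> stabilizer V" "y \<in> stabilizer V"
  then show "x + y \<in> stabilizer V"
    using vec.subspace_add[OF assms] by (auto simp: stabilizer_def distrib_right)
next
  fix c x assume x: "x \<in> stabilizer V"
  have "(c *s x) * v = c *s (x * v)" for v :: "'a ^ 'b" by (vector mult.assoc)
  then show "c *s x \<in> stabilizer V"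
    using x vec.subspace_scale[OF assms] by (auto simp: stabilizer_def)
qed

lemma stabilizer_1: "1 \<in> stabilizer V"
  by (auto simp: stabilizer_def)

lemma stabilizer_mult: "x \<in> stabilizer V \<Longrightarrow> y \<in> stabilizer V \<Longrightarrow> x * y \<in> stabilizer V"
  by (auto simp: stabilizer_def mult.assoc image_subset_iff)

lemma prod_vec_nth: "(\<Prod>a\<in>A. f a) $ i = (\<Prod>a\<in>A. (f a :: 'k::field ^ 'n) $ i)"
  by (induction A rule: infinite_finite_induct) auto

text \<open>The indicator of a level set \<open>{i. x $ i = c}\<close> is a polynomial in \<open>x\<close>, by Lagrange interpolation.\<close>

lemma stabilizer_eq_span_01:
  fixes V :: "('k::field ^ 'n) set"
  assumes "vec.subspace V"
  shows "stabilizer V = vec.span {e \<in> stabilizer V. \<forall>i. e $ i \<in> {0, 1}}"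
proof
  let ?H = "stabilizer V"
  let ?E = "{e \<in> ?H. \<forall>i. e $ i \<in> {0, 1}}"
  note sub = subspace_stabilizer[OF assms]
  show "vec.span ?E \<subseteq> ?H"
    by (rule vec.span_minimal) (use sub in auto)
  show "?H \<subseteq> vec.span ?E"
  proof
    fix x assume x: "x \<in> ?H"
    define R where "R = range (($) x)"
    \<comment> \<open>The Lagrange basis polynomial for the node \<open>c\<close> among the
      coordinate values \<open>R\<close>, evaluated at \<open>x\<close> in the algebra.\<close>
    define e where "e c = (\<Prod>b\<in>R - {c}. inverse (c - b) *s (x - b *s 1))" for c
    have fin: "finite R" by (simp add: R_def)
    have e: "e c $ i = (if x $ i = c then 1 else 0)" for c i
    proof (cases "x $ i = c")
      case True
      have "(inverse (c - b) *s (x - b *s 1)) $ i = 1" if "b \<in> R - {c}" for b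
        using that True by (simp only: vector_smult_component vector_minus_component one_index) auto
      then show ?thesis using True by (simp add: e_def prod_vec_nth del: vector_smult_component)
    next
      case False
      then have "x $ i \<in> R - {c}" by (auto simp: R_def)
      then show ?thesis using False fin by (auto simp: e_def prod_vec_nth intro!: prod_zero)
    qed
    have prod: "(\<Prod>a\<in>A. f a) \<in> ?H" if "\<And>a. a \<in> A \<Longrightarrow> f a \<in> ?H" for A :: "'k set" and f
      using that by (induction A rule: infinite_finite_induct) (auto simp: stabilizer_1 stabilizer_mult)
    have "e c \<in> ?H" for c
      unfolding e_def
      by (intro prod vec.subspace_scale[OF sub] vec.subspace_diff[OF sub] x stabilizer_1)
    then have "e c \<in> ?E" for c by (simp add: e)
    then have "(\<Sum>c\<in>R. c *s e c) \<in> vec.span ?E"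
      by (intro vec.span_sum vec.span_scale vec.span_base)
    also have "(\<Sum>c\<in>R. c *s e c) = x"
    proof (rule vec_eq_iff[THEN iffD2], rule allI)
      fix i
      have "(\<Sum>c\<in>R. c *s e c) $ i = (\<Sum>c\<in>R. if x $ i = c then c else 0)"
        by (auto simp: e intro!: sum.cong)
      also have "\<dots> = x $ i" using fin by (simp add: R_def)
      finally show "(\<Sum>c\<in>R. c *s e c) $ i = x $ i" .
    qed
    finally show "x \<in> vec.span ?E" .
  qed
qed

lemma finite_01_vectors: "finite {e :: 'k::field ^ 'n. \<forall>i. e $ i \<in> {0, 1}}"
proof -
  have "{e :: 'k ^ 'n. \<forall>i. e $ i \<in> {0, 1}} \<subseteq> range (\<lambda>A. \<chi> i. if i \<in> A then 1 else 0)"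
  proof
    fix e :: "'k ^ 'n" assume "e \<in> {e. \<forall>i. e $ i \<in> {0, 1}}"
    then have "e = (\<chi> i. if i \<in> {i. e $ i = 1} then 1 else 0)"
      by (auto simp: vec_eq_iff)
    then show "e \<in> range (\<lambda>A. \<chi> i. if i \<in> A then 1 else 0)" by blast
  qed
  then show ?thesis by (rule finite_subset) simp
qed

text \<open>A stabilizer is determined by the 0-1 vectors it contains, and there are finitely many
  of these even when the field is infinite.\<close>

lemma finite_stabilizers:
  "finite (stabilizer ` {V :: ('k::field ^ 'n) set. vec.subspace V})"
proof -
  have "stabilizer ` {V. vec.subspace V} \<subseteq> vec.span ` Pow {e :: 'k ^ 'n. \<forall>i. e $ i \<in> {0, 1}}"
  proof
    fix H :: "('k ^ 'n) set" assume "H \<in> stabilizer ` {V. vec.subspace V}"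
    then obtain V where V: "vec.subspace V" "H = stabilizer V" by auto
    then have "H = vec.span {e \<in> H. \<forall>i. e $ i \<in> {0, 1}}"
      using stabilizer_eq_span_01 by auto
    then show "H \<in> vec.span ` Pow {e. \<forall>i. e $ i \<in> {0, 1}}" by blast
  qed
  then show ?thesis by (rule finite_subset) (use finite_01_vectors in blast)
qed

section \<open>The transform over an infinite field\<close>

lemma dim_vec_mult_image:
  fixes e :: "'k::field ^ 'n"
  assumes "\<And>i. e $ i \<noteq> 0"
  shows "vec.dim ((*) e ` V) = vec.dim V"
proof (rule vec.dim_image_eq[OF linear_vec_mult_left])
  show "inj_on ((*) e) (vec.span V)"
    using assms by (auto simp: inj_on_def vec_eq_iff)
qed

lemma subspace_coordinate_zero: "vec.subspace {x :: 'k::field ^ 'n. x $ i = 0}"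
  by (auto simp: vec.subspace_def)

text \<open>The non-invertible vectors form the union of the coordinate hyperplanes. By full support
  none of these contains \<open>B\<close>, so they can be added to \<open>F\<close>.\<close>

lemma exists_invertible_outside:
  fixes B :: "('k::field ^ 'n) set"
  assumes inf: "infinite (UNIV :: 'k set)" and "vec.subspace B"
    and "\<And>i. \<exists>b\<in>B. b $ i \<noteq> 0" and "finite F"
    and "\<And>W. W \<in> F \<Longrightarrow> vec.subspace W" and "\<And>W. W \<in> F \<Longrightarrow> \<not> B \<subseteq> W"
  obtains e where "e \<in> B" "\<And>i. e $ i \<noteq> 0" "e \<notin> \<Union>F"
proof -
  let ?F = "F \<union> range (\<lambda>i. {x :: 'k ^ 'n. x $ i = 0})"
  have "\<not> B \<subseteq> \<Union>?F"
  proof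
    assume "B \<subseteq> \<Union>?F"
    then have "\<exists>W\<in>?F. B \<subseteq> W"
      using assms by (intro subspace_subset_finite_union[OF _ inf]) (auto simp: subspace_coordinate_zero)
    then show False using assms(3,6) by fastforce
  qed
  then show ?thesis using that by blast
qed

lemma transform_exists:
  fixes A B :: "('k::field ^ 'n) set"
  assumes inf: "infinite (UNIV :: 'k set)"
  assumes "vec.subspace A" "vec.subspace B" "1 \<in> A" "\<And>i. \<exists>b\<in>B. b $ i \<noteq> 0"
  shows "\<exists>V. vec.subspace V \<and> B \<subseteq> V \<and> V \<subseteq> span_prod A B \<and>
    vec.dim A + vec.dim B \<le> vec.dim V + vec.dim (stabilizer V)"
  using assms(2-)
proof (induction "vec.dim A" arbitrary: A B rule: less_induct)
  case less
  note sA = less.prems(1) and sB = less.prems(2)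
  show ?case
  proof (cases "A \<subseteq> stabilizer B")
    case True
    then have "vec.dim A \<le> vec.dim (stabilizer B)" by (rule vec.dim_subset)
    moreover have "B \<subseteq> span_prod A B"
      using mult_in_span_prod[OF less.prems(3)] by (metis mult_1 subsetI)
    ultimately show ?thesis using sB by (intro exI[of _ B]) auto
  next
    case False
    then obtain a where a: "a \<in> A" "\<not> B \<subseteq> (*) a -` B"
      by (auto simp: stabilizer_def)
    \<comment> \<open>The vectors sent into \<open>B\<close> by \<open>a\<close> form a subspace
      that does not contain \<open>B\<close>, so an invertible \<open>e\<close> in \<open>B\<close>
      can avoid it.\<close>
    obtain e where e: "e \<in> B" "\<And>i. e $ i \<noteq> 0" "a * e \<notin> B"
    proof (rule exists_invertible_outside[OF inf sB, of "{(*) a -` B}"])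
      fix W assume "W \<in> {(*) a -` B}"
      then show "vec.subspace W" using subspace_vec_mult_vimage[OF sB] by simp
    qed (use a less.prems in auto)
    \<comment> \<open>A linear analogue of Dyson's transform: \<open>1\<close> stays in
      \<open>A'\<close> because \<open>e\<close> lies in \<open>B\<close>, and \<open>a\<close>
      drops out because \<open>a * e\<close> does not.\<close>
    define A' where "A' = A \<inter> (*) e -` B"
    define B' where "B' = {x + y |x y. x \<in> B \<and> y \<in> (*) e ` A}"
    have sA': "vec.subspace A'"
      unfolding A'_def by (intro vec.subspace_inter sA subspace_vec_mult_vimage sB)
    have sB': "vec.subspace B'"
      unfolding B'_def by (intro vec.subspace_sums sB subspace_vec_mult_image sA)
    have "a \<notin> A'" using e(3) by (simp add: A'_def mult.commute)
    with a(1) have "A' \<subset> A" by (auto simp: A'_def)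
    then have "vec.dim A' < vec.dim A"
      by (intro vec.dim_psubset) (simp add: vec.span_eq_iff[THEN iffD2] sA sA')
    moreover have "1 \<in> A'" using less.prems e by (simp add: A'_def)
    moreover have BB': "B \<subseteq> B'"
      using vec.subspace_0[OF sA] by (force simp: B'_def)
    moreover have "\<exists>b\<in>B'. b $ i \<noteq> 0" for i
      using less.prems(4)[of i] BB' by blast
    ultimately obtain V where V: "vec.subspace V" "B' \<subseteq> V" "V \<subseteq> span_prod A' B'"
      "vec.dim A' + vec.dim B' \<le> vec.dim V + vec.dim (stabilizer V)"
      using less.hyps[OF _ sA' sB'] by metis
    have "span_prod A' B' \<subseteq> span_prod A B"
    proof (rule span_prod_subset[OF subspace_span_prod])
      fix x z assume x: "x \<in> A'" and "z \<in> B'"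
      then obtain b c where z: "z = b + e * c" "b \<in> B" "c \<in> A" by (auto simp: B'_def)
      \<comment> \<open>The factor \<open>e\<close> moves over to \<open>x\<close>, and
        \<open>e * x\<close> lies in \<open>B\<close> by the choice of \<open>A'\<close>.\<close>
      have "x * z = x * b + c * (e * x)" by (simp add: z(1) algebra_simps)
      also have "\<dots> \<in> span_prod A B"
        using x z by (intro vec.subspace_add[OF subspace_span_prod] mult_in_span_prod)
          (auto simp: A'_def)
      finally show "x * z \<in> span_prod A B" .
    qed
    moreover have "vec.dim A' + vec.dim B' = vec.dim A + vec.dim B"
    proof -
      \<comment> \<open>What \<open>A\<close> loses is what \<open>B\<close> gains: multiplication
        by \<open>e\<close> carries \<open>A'\<close> onto the intersection of \<open>B\<close> and
        \<open>eA\<close>, while \<open>B'\<close> is their sum.\<close>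
      have "vec.dim A' = vec.dim (B \<inter> (*) e ` A)"
      proof -
        have "B \<inter> (*) e ` A = (*) e ` A'" by (auto simp: A'_def)
        then show ?thesis using dim_vec_mult_image[OF e(2), of A'] by simp
      qed
      then show ?thesis
        using vec.dim_sums_Int[OF sB subspace_vec_mult_image[OF sA, of e]] dim_vec_mult_image[OF e(2), of A]
        by (simp add: B'_def)
    qed
    ultimately show ?thesis using V BB' by (intro exI[of _ V]) auto
  qed
qed

lemma kneser_infinite_full_support:
  fixes A B :: "('k::field ^ 'n) set"
  assumes inf: "infinite (UNIV :: 'k set)"
    and sA: "vec.subspace A" and sB: "vec.subspace B"
    and fA: "\<And>i. \<exists>a\<in>A. a $ i \<noteq> 0" and fB: "\<And>i. \<exists>b\<in>B. b $ i \<noteq> 0"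
  shows "vec.dim A + vec.dim B \<le> vec.dim (span_prod A B) + vec.dim (stabilizer (span_prod A B))"
proof -
  \<comment> \<open>Only an inclusion of \<open>H\<close> in the stabilizer is required, so that
    \<open>H\<close> survives both the rescaling by \<open>a\<close> and the summation over many
    \<open>a\<close>.\<close>
  define good where "good H a \<longleftrightarrow> (\<exists>V. vec.subspace V \<and> (*) a ` B \<subseteq> V \<and> V \<subseteq> span_prod A B \<and>
      H \<subseteq> stabilizer V \<and> vec.dim A + vec.dim B \<le> vec.dim V + vec.dim H)" for H a
  define HS where "HS = stabilizer ` {V :: ('k ^ 'n) set. vec.subspace V}"
  have ex: "\<exists>H\<in>HS. good H a" if a: "a \<in> A" "\<And>i. a $ i \<noteq> 0" for a
  proof -
    \<comment> \<open>The inverse of \<open>a\<close>; scaling \<open>A\<close> by it produces a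
      space containing \<open>1\<close>.\<close>
    define c where "c = (\<chi> i. inverse (a $ i))"
    have ca: "c * a = 1" and ac: "a * (c * x) = x" for x
      using a(2) by (auto simp: c_def vec_eq_iff)
    have c0: "c $ i \<noteq> 0" for i using a(2) by (simp add: c_def)
    have "1 \<in> (*) c ` A" using a(1) ca by (metis imageI)
    from transform_exists[OF inf subspace_vec_mult_image[OF sA] sB this fB] obtain V where V:
      "vec.subspace V" "B \<subseteq> V" "V \<subseteq> span_prod ((*) c ` A) B"
      "vec.dim A + vec.dim B \<le> vec.dim V + vec.dim (stabilizer V)"
      by (auto simp: dim_vec_mult_image[OF c0])
    have "span_prod ((*) c ` A) B \<subseteq> (*) a -` span_prod A B"
    proof (rule span_prod_subset[OF subspace_vec_mult_vimage[OF subspace_span_prod]])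
      fix x y assume "x \<in> (*) c ` A" "y \<in> B"
      then show "x * y \<in> (*) a -` span_prod A B"
        by (auto simp: mult.assoc ac intro: mult_in_span_prod)
    qed
    moreover have "stabilizer V \<subseteq> stabilizer ((*) a ` V)"
      by (force simp: stabilizer_def mult.left_commute)
    ultimately have "good (stabilizer V) a"
      unfolding good_def using V
      by (intro exI[of _ "(*) a ` V"]) (auto simp: subspace_vec_mult_image dim_vec_mult_image[OF a(2)])
    then show ?thesis using V(1) by (auto simp: HS_def)
  qed
  text \<open>The finitely many sets \<open>{a. good H a}\<close> cover the invertible elements of \<open>A\<close>, so that one of
    them spans \<open>A\<close>.\<close>
  have "\<exists>H\<in>HS. A \<subseteq> vec.span {a. good H a}"
  proof (rule ccontr)
    assume contra: "\<not> ?thesis"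
    obtain e where e: "e \<in> A" "\<And>i. e $ i \<noteq> 0" "e \<notin> \<Union>((\<lambda>H. vec.span {a. good H a}) ` HS)"
      by (rule exists_invertible_outside[OF inf sA fA, of "(\<lambda>H. vec.span {a. good H a}) ` HS"])
        (use contra in \<open>auto simp: HS_def finite_stabilizers\<close>)
    obtain H where H: "H \<in> HS" "good H e" using ex[OF e(1,2)] by auto
    then have "e \<in> vec.span {a. good H a}" by (intro vec.span_base) simp
    with e(3) H(1) show False by auto
  qed
  then obtain H where H: "H \<in> HS" "A \<subseteq> vec.span {a. good H a}" by auto
  have "H \<subseteq> stabilizer (span_prod A B)"
  proof
    fix h assume h: "h \<in> H"
    have "span_prod A B \<subseteq> (*) h -` span_prod A B"
    proof (rule span_prod_subset[OF subspace_vec_mult_vimage[OF subspace_span_prod]])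
      fix x y assume x: "x \<in> A" and y: "y \<in> B"
      \<comment> \<open>For fixed \<open>h\<close> and \<open>y\<close> the claim is linear in
        \<open>a\<close>, so it is enough to check the good \<open>a\<close>, where \<open>h\<close>
        moves \<open>a * y\<close> within \<open>V\<close>.\<close>
      have "vec.span {a. good H a} \<subseteq> (*) (h * y) -` span_prod A B"
      proof (rule vec.span_minimal[OF _ subspace_vec_mult_vimage[OF subspace_span_prod]], rule subsetI)
        fix a assume "a \<in> {a. good H a}"
        then obtain V where V: "(*) a ` B \<subseteq> V" "V \<subseteq> span_prod A B" "H \<subseteq> stabilizer V"
          by (auto simp: good_def)
        then have "h * (a * y) \<in> V" using h y by (force simp: stabilizer_def)
        then show "a \<in> (*) (h * y) -` span_prod A B" using V(2) by (auto simp: mult_ac)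
      qed
      then show "x * y \<in> (*) h -` span_prod A B" using x H(2) by (auto simp: mult_ac)
    qed
    then show "h \<in> stabilizer (span_prod A B)" by (auto simp: stabilizer_def)
  qed
  then have "vec.dim H \<le> vec.dim (stabilizer (span_prod A B))" by (rule vec.dim_subset)
  \<comment> \<open>\<open>A\<close> is nonzero, so its spanning set of good elements is
    nonempty.\<close>
  moreover obtain a where "good H a"
  proof -
    obtain a i where "a \<in> A" "a $ i \<noteq> 0" using fA by blast
    then have "\<not> A \<subseteq> vec.span {}" by auto
    then have "{a. good H a} \<noteq> {}" using H(2) by force
    then show ?thesis using that by auto
  qed
  then obtain V where V: "V \<subseteq> span_prod A B" "vec.dim A + vec.dim B \<le> vec.dim V + vec.dim H"
    by (auto simp: good_def)
  moreover have "vec.dim V \<le> vec.dim (span_prod A B)" by (rule vec.dim_subset[OF V(1)])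
  ultimately show ?thesis by linarith
qed


section \<open>Removing the support condition\<close>

text \<open>Adding \<open>K^J\<close> to both factors, where \<open>J\<close> is the complement of the support of \<open>ST\<close>, makes
  the supports full and adds \<open>K^J\<close> to the product.\<close>

lemma kneser_infinite:
  fixes S T :: "('k::field ^ 'n) set"
  assumes inf: "infinite (UNIV :: 'k set)" and sS: "vec.subspace S" and sT: "vec.subspace T"
  shows "vec.dim S + vec.dim T \<le> vec.dim (span_prod S T) + vec.dim (stabilizer (span_prod S T))"
proof -
  define J where "J = {i. (\<forall>s\<in>S. s $ i = 0) \<or> (\<forall>t\<in>T. t $ i = 0)}"
  define KJ where "KJ = {x :: 'k ^ 'n. \<forall>i. i \<notin> J \<longrightarrow> x $ i = 0}"
  define S1 where "S1 = {x + y |x y. x \<in> S \<and> y \<in> KJ}"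
  define T1 where "T1 = {x + y |x y. x \<in> T \<and> y \<in> KJ}"
  define P where "P = span_prod S T"
  define P1 where "P1 = {x + y |x y. x \<in> P \<and> y \<in> KJ}"
  have sKJ: "vec.subspace KJ" by (auto simp: KJ_def vec.subspace_def)
  have sP: "vec.subspace P" by (simp add: P_def subspace_span_prod)
  have sS1: "vec.subspace S1" and sT1: "vec.subspace T1" and sP1: "vec.subspace P1"
    unfolding S1_def T1_def P1_def by (intro vec.subspace_sums sS sT sP sKJ)+
  have 0: "0 \<in> S" "0 \<in> T" "0 \<in> P" "0 \<in> KJ"
    using sS sT sP sKJ by (auto simp: vec.subspace_0)
  have SS1: "S \<subseteq> S1" "KJ \<subseteq> S1" and TT1: "T \<subseteq> T1" "KJ \<subseteq> T1"
    and PP1: "P \<subseteq> P1" "KJ \<subseteq> P1"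
    using 0 by (force simp: S1_def T1_def P1_def)+
  have KJ_ideal: "x * y \<in> KJ" "y * x \<in> KJ" if "y \<in> KJ" for x y
    using that by (auto simp: KJ_def)
  have PJ: "x $ i = 0" if "x \<in> P" "i \<in> J" for x i
  proof -
    have "P \<subseteq> {x. x $ i = 0}"
      unfolding P_def using \<open>i \<in> J\<close>
      by (intro span_prod_subset subspace_coordinate_zero) (auto simp: J_def)
    then show ?thesis using that by auto
  qed
  have J_full: "\<exists>x\<in>KJ. x $ i \<noteq> 0" if "i \<in> J" for i
    using that by (intro bexI[of _ "axis i 1"]) (auto simp: KJ_def axis_def)
  have full: "\<exists>s\<in>S1. s $ i \<noteq> 0" "\<exists>t\<in>T1. t $ i \<noteq> 0" for i
    using J_full[of i] SS1 TT1 by (cases "i \<in> J"; force simp: J_def)+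
  have eq: "span_prod S1 T1 = P1"
  proof
    show "span_prod S1 T1 \<subseteq> P1"
    proof (rule span_prod_subset[OF sP1])
      fix x y assume "x \<in> S1" "y \<in> T1"
      then obtain s k t l where *: "x = s + k" "y = t + l" "s \<in> S" "t \<in> T" "k \<in> KJ" "l \<in> KJ"
        by (auto simp: S1_def T1_def)
      have "x * y = s * t + (s * l + k * y)" by (simp add: * algebra_simps)
      moreover have "s * t \<in> P" using * by (simp add: P_def mult_in_span_prod)
      moreover have "s * l + k * y \<in> KJ" using * by (intro vec.subspace_add[OF sKJ] KJ_ideal)
      ultimately show "x * y \<in> P1" by (auto simp: P1_def)
    qed
    have "KJ \<subseteq> span_prod S1 T1"
    proof
      fix x assume x: "x \<in> KJ"
      \<comment> \<open>The identity element of the ideal \<open>KJ\<close>.\<close>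
      define u :: "'k ^ 'n" where "u = (\<chi> i. if i \<in> J then 1 else 0)"
      have "u \<in> KJ" by (simp add: KJ_def u_def)
      moreover have "x = x * u" using x by (auto simp: vec_eq_iff u_def KJ_def)
      ultimately show "x \<in> span_prod S1 T1"
        using mult_in_span_prod[of x S1 u T1] x SS1 TT1 by auto
    qed
    moreover have "P \<subseteq> span_prod S1 T1"
      unfolding P_def by (rule span_prod_mono[OF SS1(1) TT1(1)])
    ultimately show "P1 \<subseteq> span_prod S1 T1"
      by (auto simp: P1_def intro!: vec.subspace_add[OF subspace_span_prod])
  qed
  \<comment> \<open>All of \<open>P\<close> vanishes on \<open>J\<close>, hence so does
    \<open>x * p\<close>, and its component in \<open>KJ\<close> must be zero.\<close>
  have stab: "stabilizer P1 \<subseteq> stabilizer P"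
  proof
    fix x assume x: "x \<in> stabilizer P1"
    have "x * p \<in> P" if p: "p \<in> P" for p
    proof -
      have "x * p \<in> P1" using x p PP1 by (auto simp: stabilizer_def)
      then obtain q y where q: "x * p = q + y" "q \<in> P" "y \<in> KJ" by (auto simp: P1_def)
      have "y $ i = 0" for i
        using arg_cong[OF q(1), of "\<lambda>v. v $ i"] q(3) PJ[OF p, of i] PJ[OF q(2), of i]
        by (cases "i \<in> J") (auto simp: KJ_def)
      then have "y = 0" by (simp add: vec_eq_iff)
      with q show ?thesis by simp
    qed
    then show "x \<in> stabilizer P" by (auto simp: stabilizer_def)
  qed
  have "vec.dim S1 + vec.dim T1 \<le> vec.dim P1 + vec.dim (stabilizer P1)"
    using kneser_infinite_full_support[OF inf sS1 sT1 full] by (simp add: eq)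
  moreover have "vec.dim (stabilizer P1) \<le> vec.dim (stabilizer P)"
    by (rule vec.dim_subset[OF stab])
  moreover have "vec.dim S1 + vec.dim (S \<inter> KJ) = vec.dim S + vec.dim KJ"
    unfolding S1_def by (rule vec.dim_sums_Int[OF sS sKJ])
  moreover have "vec.dim T1 + vec.dim (T \<inter> KJ) = vec.dim T + vec.dim KJ"
    unfolding T1_def by (rule vec.dim_sums_Int[OF sT sKJ])
  moreover have "vec.dim P1 + vec.dim (P \<inter> KJ) = vec.dim P + vec.dim KJ"
    unfolding P1_def by (rule vec.dim_sums_Int[OF sP sKJ])
  \<comment> \<open>At each coordinate in \<open>J\<close> one of \<open>S\<close> and
    \<open>T\<close> vanishes, so the two intersections are independent inside \<open>KJ\<close>.
    Hence the factors together gain at least the dimension of \<open>KJ\<close>, and the product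
    gains at most that.\<close>
  moreover have "vec.dim (S \<inter> KJ) + vec.dim (T \<inter> KJ) \<le> vec.dim KJ"
  proof -
    let ?U = "{x + y |x y. x \<in> S \<inter> KJ \<and> y \<in> T \<inter> KJ}"
    have "x = 0" if "x \<in> S" "x \<in> T" "x \<in> KJ" for x
      using that by (auto simp: vec_eq_iff KJ_def J_def)
    then have "(S \<inter> KJ) \<inter> (T \<inter> KJ) = {0}" using 0 by auto
    then have "vec.dim (S \<inter> KJ) + vec.dim (T \<inter> KJ) = vec.dim ?U"
      using vec.dim_sums_Int[of "S \<inter> KJ" "T \<inter> KJ"] by (simp add: vec.subspace_inter sS sT sKJ)
    also have "\<dots> \<le> vec.dim KJ"
      by (rule vec.dim_subset) (auto intro: vec.subspace_add[OF sKJ])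
    finally show ?thesis .
  qed
  ultimately show ?thesis unfolding P_def by linarith
qed

section \<open>Extension of scalars\<close>

text \<open>The laws of a unital ring homomorphism suffice: injectivity follows because nonzero
  elements of a field are units.\<close>

locale field_embedding =
  fixes h :: "'k::field \<Rightarrow> 'l::field"
  assumes h_add: "h (x + y) = h x + h y" and h_mult: "h (x * y) = h x * h y" and h_1: "h 1 = 1"
begin

lemma h_0: "h 0 = 0"
  using h_add[of 0 0] by (simp only: add_0_left add_cancel_right_right)

lemma h_eq_0_iff: "h x = 0 \<longleftrightarrow> x = 0"
  using h_mult[of x "inverse x"] by (cases "x = 0") (auto simp: h_0 h_1)

lemma h_sum: "h (sum f A) = (\<Sum>a\<in>A. h (f a))"
  by (induction A rule: infinite_finite_induct) (auto simp: h_0 h_add)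

definition ext :: "'k ^ 'n \<Rightarrow> 'l ^ 'n" where
  "ext x = (\<chi> i. h (x $ i))"

lemma ext_nth [simp]: "ext x $ i = h (x $ i)"
  by (simp add: ext_def)

lemma ext_add: "ext (x + y) = ext x + ext y"
  by (simp add: vec_eq_iff h_add)

lemma ext_mult: "ext (x * y) = ext x * ext y"
  by (simp add: vec_eq_iff h_mult)

lemma ext_scale: "ext (c *s x) = h c *s ext x"
  by (simp add: vec_eq_iff h_mult)

lemma ext_eq_0_iff: "ext x = 0 \<longleftrightarrow> x = 0"
  by (simp add: vec_eq_iff h_eq_0_iff)

lemma inj_ext: "inj ext"
proof (rule injI)
  fix x y :: "'k ^ 'n" assume *: "ext x = ext y"
  have "ext (x - y) + ext y = ext x" by (simp flip: ext_add)
  then show "x = y" using * by (simp add: ext_eq_0_iff)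
qed

lemma subspace_ext_vimage:
  assumes "vec.subspace W"
  shows "vec.subspace (ext -` W)"
  using assms by (auto simp: vec.subspace_def ext_add ext_scale ext_eq_0_iff[THEN iffD2])

text \<open>A matrix over the small field that kills \<open>V\<close> but not \<open>v\<close> does the same over the large field.\<close>

lemma ext_in_span_iff:
  assumes V: "vec.subspace V"
  shows "ext v \<in> vec.span (ext ` V) \<longleftrightarrow> v \<in> V"
proof
  assume v: "ext v \<in> vec.span (ext ` V)"
  show "v \<in> V"
  proof (rule ccontr)
    assume nv: "v \<notin> V"
    obtain B where B: "B \<subseteq> V" "vec.independent B" "V \<subseteq> vec.span B"
      using vec.basis_exists[of V] by metis
    have "vec.span B \<subseteq> V" using B(1) V by (rule vec.span_minimal)
    then have "v \<notin> vec.span B" using nv by auto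
    then have "vec.independent (insert v B)" using B(2) by (simp add: vec.independent_insert)
    from vec.linear_independent_extend[OF this, of "\<lambda>x. if x = v then v else 0"]
    obtain g :: "'k ^ 'a \<Rightarrow> 'k ^ 'a" where lin: "Vector_Spaces.linear (*s) (*s) g"
      and g: "\<And>x. x \<in> insert v B \<Longrightarrow> g x = (if x = v then v else 0)"
      by blast
    have gV: "g x = 0" if "x \<in> V" for x
    proof (rule vec.linear_eq_0_on_span[OF lin])
      show "x \<in> vec.span B" using that B(3) by auto
      show "g b = 0" if "b \<in> B" for b using g[of b] that B(1) nv by auto
    qed
    \<comment> \<open>Applying \<open>h\<close> to each matrix entry of \<open>g\<close> gives a map
      that agrees with \<open>g\<close> along \<open>ext\<close>.\<close>
    define M :: "'l ^ 'a ^ 'a" where "M = (\<chi> i j. h (matrix g $ i $ j))"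
    have M: "M *v ext x = ext (g x)" for x
    proof -
      have "M *v ext x = ext (matrix g *v x)"
        by (simp add: vec_eq_iff M_def matrix_vector_mult_def h_sum h_mult)
      then show ?thesis by (simp add: matrix_works[OF lin])
    qed
    have "M *v ext v = 0"
      by (rule vec.linear_eq_0_on_span[OF matrix_vector_mul_linear_gen _ v])
        (auto simp: M gV ext_eq_0_iff)
    then have "v = 0" using g[of v] by (simp add: M ext_eq_0_iff)
    then show False using nv vec.subspace_0[OF V] by simp
  qed
qed (auto intro: vec.span_base)

lemma ext_span_subset: "ext ` vec.span B \<subseteq> vec.span (ext ` B)"
proof -
  have "vec.span B \<subseteq> ext -` vec.span (ext ` B)"
    by (rule vec.span_minimal) (auto intro: vec.span_base subspace_ext_vimage)
  then show ?thesis by auto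
qed

text \<open>A basis of \<open>V\<close> stays independent over the larger field, since
  \<open>ext_in_span_iff\<close> pulls any dependence back to the smaller one.\<close>

lemma dim_ext: "vec.dim (ext ` V) = vec.dim V"
proof -
  obtain B where B: "B \<subseteq> V" "vec.independent B" "V \<subseteq> vec.span B" "card B = vec.dim V"
    using vec.basis_exists[of V] by metis
  have "vec.independent (ext ` B)"
    unfolding vec.dependent_def
  proof safe
    fix b assume b: "b \<in> B" "ext b \<in> vec.span (ext ` B - {ext b})"
    have "ext ` B - {ext b} = ext ` (B - {b})"
      using inj_ext by (auto dest: injD)
    also have "vec.span \<dots> \<subseteq> vec.span (ext ` vec.span (B - {b}))"
      by (intro vec.span_mono image_mono vec.span_superset)
    finally have "b \<in> vec.span (B - {b})"
      using b(2) by (auto simp flip: ext_in_span_iff)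
    then show False using B(2) b(1) by (auto simp: vec.dependent_def)
  qed
  moreover have "ext ` V \<subseteq> vec.span (ext ` B)"
    using ext_span_subset[of B] B(3) by blast
  ultimately show ?thesis
    using B(1,4) inj_on_subset[OF inj_ext, of B]
    by (intro vec.dim_unique[of "ext ` B"]) (auto simp: card_image)
qed

lemma span_prod_ext:
  "span_prod (vec.span (ext ` S)) (vec.span (ext ` T)) = vec.span (ext ` span_prod S T)"
  (is "?Q = ?P")
proof
  show "?Q \<subseteq> ?P"
  proof (rule span_prod_subset)
    fix x y assume x: "x \<in> vec.span (ext ` S)" and y: "y \<in> vec.span (ext ` T)"
    \<comment> \<open>Bilinearity is used one factor at a time: first \<open>y\<close> varies with
      \<open>s\<close> fixed, then \<open>x\<close> varies.\<close>
    have "ext s * y \<in> ?P" if "s \<in> S" for s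
    proof -
      have "vec.span (ext ` T) \<subseteq> (*) (ext s) -` ?P"
        using that by (intro vec.span_minimal subspace_vec_mult_vimage)
          (auto simp flip: ext_mult intro!: vec.span_base imageI mult_in_span_prod)
      then show ?thesis using y by auto
    qed
    then have "vec.span (ext ` S) \<subseteq> (*) y -` ?P"
      by (intro vec.span_minimal subspace_vec_mult_vimage) (auto simp: mult.commute[of y])
    then show "x * y \<in> ?P" using x by (auto simp: mult.commute[of y])
  qed simp
  have "span_prod S T \<subseteq> ext -` ?Q"
    by (rule span_prod_subset[OF subspace_ext_vimage[OF subspace_span_prod]])
      (auto simp: ext_mult intro!: mult_in_span_prod vec.span_base)
  then show "?P \<subseteq> ?Q"
    by (intro vec.span_minimal subspace_span_prod) auto
qed

text \<open>The stabilizer over the larger field is spanned by 0-1 vectors. These already exist over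
  the smaller field and stabilize \<open>P\<close> there, so no new dimensions appear.\<close>

lemma dim_stabilizer_ext_le:
  assumes P: "vec.subspace P"
  shows "vec.dim (stabilizer (vec.span (ext ` P))) \<le> vec.dim (stabilizer P)"
proof -
  let ?P = "vec.span (ext ` P)"
  have "{e \<in> stabilizer ?P. \<forall>i. e $ i \<in> {0, 1}} \<subseteq> ext ` stabilizer P"
  proof safe
    fix e assume e: "e \<in> stabilizer ?P" "\<forall>i. e $ i \<in> {0, 1}"
    define d :: "'k ^ 'a" where "d = (\<chi> i. if e $ i = 0 then 0 else 1)"
    have d: "e = ext d" using e(2) by (auto simp: vec_eq_iff d_def h_0 h_1)
    have "d * p \<in> P" if "p \<in> P" for p
    proof -
      have "ext (d * p) \<in> ?P"
        using e(1) that by (auto simp: d ext_mult stabilizer_def intro: vec.span_base)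
      then show ?thesis by (simp add: ext_in_span_iff[OF P])
    qed
    then show "e \<in> ext ` stabilizer P" by (auto simp: d stabilizer_def)
  qed
  then have "stabilizer ?P \<subseteq> vec.span (ext ` stabilizer P)"
    by (subst stabilizer_eq_span_01) (auto dest: vec.span_mono)
  then have "vec.dim (stabilizer ?P) \<le> vec.dim (ext ` stabilizer P)" by (rule vec.dim_mono)
  then show ?thesis by (simp add: dim_ext)
qed

lemma kneser_transfer:
  fixes S T :: "('k ^ 'n) set"
  assumes inf: "infinite (UNIV :: 'l set)" and "vec.subspace S" and "vec.subspace T"
  shows "vec.dim S + vec.dim T \<le> vec.dim (span_prod S T) + vec.dim (stabilizer (span_prod S T))"
proof -
  have "vec.dim S + vec.dim T = vec.dim (vec.span (ext ` S)) + vec.dim (vec.span (ext ` T))"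
    by (simp add: dim_ext)
  also have "\<dots> \<le> vec.dim (vec.span (ext ` span_prod S T))
      + vec.dim (stabilizer (vec.span (ext ` span_prod S T)))"
    unfolding span_prod_ext[symmetric] by (intro kneser_infinite[OF inf]) auto
  also have "\<dots> \<le> vec.dim (span_prod S T) + vec.dim (stabilizer (span_prod S T))"
    using dim_stabilizer_ext_le[OF subspace_span_prod, of S T] by (simp add: dim_ext)
  finally show ?thesis .
qed

end

lemma infinite_UNIV_poly_fract: "infinite (UNIV :: 'k::field poly fract set)"
proof -
  have "inj (\<lambda>n. Fract (monom (1 :: 'k) n) 1)"
    by (rule injI) (simp add: eq_fract monom_eq_iff')
  from range_inj_infinite[OF this] show ?thesis
    using infinite_super[OF subset_UNIV] by blast
qed

theorem theorem3p3:
  fixes S T :: "('k::field ^ 'n) set"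
  assumes "vec.subspace S" and "vec.subspace T"
    and "S \<noteq> {0}" and "T \<noteq> {0}"
  shows "int (vec.dim (span_prod S T))
    \<ge> int (vec.dim S) + int (vec.dim T) - int (vec.dim (stabilizer (span_prod S T)))"
proof -
  \<comment> \<open>Constants embed \<open>K\<close> into the rational functions, which are infinite
    for every \<open>K\<close>, so finite and infinite fields are treated alike.\<close>
  interpret field_embedding "\<lambda>c :: 'k. Fract [:c:] 1"
    by unfold_locales (simp_all add: One_fract_def one_pCons mult.commute)
  show ?thesis
    using kneser_transfer[OF infinite_UNIV_poly_fract assms(1,2)] by linarith
qed

end
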